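(* Let $p\geq 1$ be an integer and let $G\in \mathbf{W}_{p}$. For a non-isolated vertex $v$ of $G$, the following conditions are equivalent: (a) $G-v$ is in $\mathbf{W}_{p}$; (b) $\left\vert N_{G}(v)\setminus N_{G}(S)\right\vert \geq p$ for every independent set $S$ of $G_{v}$; (c) there is no independent set $S\subseteq V(G_{v})$ such that $\left\vert N_{G_{S}}(v)\right\vert \leq p-1$.
   Context: All graphs are finite, undirected, loopless and without multiple edges; $V(G)$ is the vertex set and $n(G)=|V(G)|$. An independent set is a set of pairwise non-adjacent vertices (the empty set is independent); $\alpha(G)$ is the largest cardinality of an independent set, and a maximum independent set is an independent set of cardinality $\alpha(G)$. For a positive integer $p$, a graph $G$ belongs to the class $\mathbf{W}_p$ if $n(G)\geq p$ and, for every collection of $p$ pairwise disjoint independent sets $A_1,\ldots,A_p$ in $G$, there exist $p$ pairwise disjoint maximum independent sets $S_1,\ldots,S_p$ of $G$ such that $A_i\subseteq S_i$ for all $1\leq i\leq p$. For $S\subseteq V(G)$, $N_G(S)$ is the set of vertices in $V(G)\setminus S$ that are adjacent to some vertex of $S$ (so $N_G(\emptyset)=\emptyset$), $N_G[S]=S\cup N_G(S)$, and $G_S=G-N_G[S]$ is the subgraph of $G$ induced on $V(G)\setminus N_G[S]$. For a single vertex $v$, write $N_G(v)$, $N_G[v]$, $G_v$ for $N_G(\{v\})$, $N_G[\{v\}]$, $G_{\{v\}}$; $G-v$ is the graph obtained by deleting $v$. A vertex is isolated if it has no neighbors. *)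

theory Defs
  imports "Graph_Theory.Graph_Theory"
begin

text \<open>
  The locale predicate \<^const>\<open>graph\<close> describes the finite simple undirected graphs, an edge \<open>uv\<close>
  being a pair of opposite arcs; adjacency is \<open>u \<rightarrow>\<^bsub>G\<^esub> v\<close>. The null graph is allowed.
\<close>

definition independent_set :: "('a,'b) pre_digraph \<Rightarrow> 'a set \<Rightarrow> bool" where
  "independent_set G S \<longleftrightarrow> S \<subseteq> verts G \<and> (\<forall>u\<in>S. \<forall>w\<in>S. \<not> u \<rightarrow>\<^bsub>G\<^esub> w)"

definition independence_number :: "('a,'b) pre_digraph \<Rightarrow> nat" where
  "independence_number G = Max (card ` {S. independent_set G S})"

definition max_independent_set :: "('a,'b) pre_digraph \<Rightarrow> 'a set \<Rightarrow> bool" where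
  "max_independent_set G S \<longleftrightarrow> independent_set G S \<and> card S = independence_number G"

text \<open>
  The collections are indexed families, so that \<open>A i = A j = {}\<close> is allowed for \<open>i \<noteq> j\<close>.
\<close>

definition W_class :: "nat \<Rightarrow> ('a,'b) pre_digraph set" where
  "W_class p = {G. graph G \<and> p \<le> card (verts G) \<and>
     (\<forall>A :: nat \<Rightarrow> 'a set.
        (\<forall>i\<in>{1..p}. independent_set G (A i)) \<and> disjoint_family_on A {1..p} \<longrightarrow>
        (\<exists>S :: nat \<Rightarrow> 'a set.
           (\<forall>i\<in>{1..p}. max_independent_set G (S i)) \<and> disjoint_family_on S {1..p} \<and>
           (\<forall>i\<in>{1..p}. A i \<subseteq> S i)))}"

definition nbhd :: "('a,'b) pre_digraph \<Rightarrow> 'a set \<Rightarrow> 'a set" where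
  "nbhd G S = {u \<in> verts G - S. \<exists>w\<in>S. w \<rightarrow>\<^bsub>G\<^esub> u}"

definition closed_nbhd :: "('a,'b) pre_digraph \<Rightarrow> 'a set \<Rightarrow> 'a set" where
  "closed_nbhd G S = S \<union> nbhd G S"

text \<open>The graph written \<open>G\<^sub>S\<close>, and \<open>G\<^sub>v\<close> when \<open>S = {v}\<close>.\<close>

definition localization :: "('a,'b) pre_digraph \<Rightarrow> 'a set \<Rightarrow> ('a,'b) pre_digraph" where
  "localization G S = G \<restriction> (verts G - closed_nbhd G S)"

definition isolated :: "('a,'b) pre_digraph \<Rightarrow> 'a \<Rightarrow> bool" where
  "isolated G v \<longleftrightarrow> nbhd G {v} = {}"

end

theory Submission
  imports Defs
begin

text \<open>
  Two observations carry the proof. First, since \<open>v\<close> has a neighbour \<open>u\<close>, extending \<open>{u}\<close> to a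
  maximum independent set gives one that avoids \<open>v\<close>; hence \<open>G\<close> and \<open>G - v\<close> have the same independence
  number, and the maximum independent sets of \<open>G - v\<close> are those of \<open>G\<close> that avoid \<open>v\<close>
  (\<open>max_independent_set_del_vert_iff\<close>). Second, an independent set of \<open>G\<^sub>v\<close> is a set \<open>S\<close> for which
  \<open>S \<union> {v}\<close> is an independent set with a new element \<open>v\<close>
  (\<open>independent_set_localization_singleton\<close>). Call \<open>N(v) - N(S)\<close> the free neighbours of \<open>v\<close>: each
  of them can replace \<open>v\<close> in \<open>S \<union> {v}\<close>.

  If \<open>G - v\<close> is in \<open>W\<^sub>p\<close> and \<open>S\<close> leaves \<open>v\<close> fewer than \<open>p\<close> free neighbours, then \<open>S\<close> together with
  the singletons of the free neighbours are at most \<open>p\<close> disjoint independent sets of \<open>G - v\<close>. In a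
  family of disjoint maximum independent sets extending them, the one containing \<open>S\<close> contains no
  neighbour of \<open>v\<close>, so adding \<open>v\<close> to it exceeds the independence number.

  Conversely, extend a family given in \<open>G - v\<close> to disjoint maximum independent sets of \<open>G\<close>. At most
  one of them, say \<open>M\<close>, contains \<open>v\<close>. The free neighbours for \<open>S = M - {v}\<close> form a clique, as
  otherwise \<open>v\<close> could be exchanged for two of them. So each of the \<open>p - 1\<close> other sets contains at most
  one of the \<open>p\<close> or more free neighbours, some free neighbour is in none of them, and exchanging \<open>v\<close>
  for it in \<open>M\<close> gives the required family.

  The third condition is a rewording of the second, because \<open>v\<close> has in \<open>G\<^sub>S\<close> exactly its free
  neighbours.
\<close>

section \<open>Independent sets\<close>

context graph
begin

lemma dominates_sym: "u \<rightarrow>\<^bsub>G\<^esub> w \<Longrightarrow> w \<rightarrow>\<^bsub>G\<^esub> u"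
  using sym_arcs arcs_ends_symmetric by metis

lemma not_dominates_self: "\<not> u \<rightarrow>\<^bsub>G\<^esub> u"
  using adj_not_same by blast

lemma finite_independent_set: "independent_set G S \<Longrightarrow> finite S"
  unfolding independent_set_def by (metis finite_verts finite_subset)

lemma finite_independent_sets: "finite {S. independent_set G S}"
  by (rule finite_subset[of _ "Pow (verts G)"]) (auto simp: independent_set_def)

lemma card_le_independence_number:
  "independent_set G S \<Longrightarrow> card S \<le> independence_number G"
  unfolding independence_number_def using finite_independent_sets by (intro Max_ge) auto

lemma independent_set_singleton: "u \<in> verts G \<Longrightarrow> independent_set G {u}"
  by (auto simp: independent_set_def not_dominates_self)

lemma independent_set_insert_iff:
  "independent_set G (insert u S) \<longleftrightarrow>
     u \<in> verts G \<and> independent_set G S \<and> (\<forall>w\<in>S. \<not> w \<rightarrow>\<^bsub>G\<^esub> u)"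
  using not_dominates_self dominates_sym by (auto simp: independent_set_def)

lemma graph_del_vert: "graph (del_vert v)"
proof -
  have "fin_digraph (del_vert v)" by (rule fin_digraph_del_vert)
  moreover have "symmetric (del_vert v)"
    using sym_arcs unfolding symmetric_conv del_vert_simps by fastforce
  ultimately show ?thesis
    by (simp add: graph_def digraph_def pseudo_graph_def sym_digraph_def fin_digraph_def
        loopfree_digraph_def loopfree_digraph_axioms_def nomulti_digraph_def
        nomulti_digraph_axioms_def sym_digraph_axioms_def del_vert_simps ends_del_vert
        no_loops no_multi_arcs)
qed

lemma dominates_del_vert_iff: "a \<rightarrow>\<^bsub>del_vert v\<^esub> b \<longleftrightarrow> a \<rightarrow>\<^bsub>G\<^esub> b \<and> a \<noteq> v \<and> b \<noteq> v"
  by (auto simp: arcs_ends_conv del_vert_simps)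

lemma independent_set_del_vert_iff:
  "independent_set (del_vert v) S \<longleftrightarrow> independent_set G S \<and> v \<notin> S"
  by (auto simp: independent_set_def dominates_del_vert_iff verts_del_vert)

text \<open>
  Since \<open>M\<close> survives the deletion of \<open>v\<close>, the independence number does not drop, and a set of that
  size is maximum in both graphs.
\<close>

lemma max_independent_set_del_vert_iff:
  assumes "max_independent_set G M" "v \<notin> M"
  shows "max_independent_set (del_vert v) S \<longleftrightarrow> max_independent_set G S \<and> v \<notin> S"
proof -
  interpret D: graph "del_vert v" by (rule graph_del_vert)
  have "independence_number (del_vert v) = Max (card ` {S. independent_set (del_vert v) S})"
    by (simp add: independence_number_def)
  also have "\<dots> = independence_number G"
  proof (rule Max_eqI)
    show "finite (card ` {S. independent_set (del_vert v) S})"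
      using D.finite_independent_sets by blast
    show "k \<le> independence_number G" if "k \<in> card ` {S. independent_set (del_vert v) S}" for k
      using that card_le_independence_number by (auto simp: independent_set_del_vert_iff)
    show "independence_number G \<in> card ` {S. independent_set (del_vert v) S}"
      using assms by (force simp: max_independent_set_def independent_set_del_vert_iff)
  qed
  finally show ?thesis
    by (auto simp: max_independent_set_def independent_set_del_vert_iff)
qed

section \<open>Localizations and free neighbours\<close>

lemma nbhd_singleton: "nbhd G {v} = {u. v \<rightarrow>\<^bsub>G\<^esub> u}"
  using not_dominates_self adj_in_verts by (auto simp: nbhd_def)

lemma dominates_induce_iff: "a \<rightarrow>\<^bsub>G \<restriction> X\<^esub> b \<longleftrightarrow> a \<rightarrow>\<^bsub>G\<^esub> b \<and> a \<in> X \<and> b \<in> X"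
  by (auto simp: arcs_ends_conv)

lemma independent_set_localization_iff:
  "independent_set (localization G T) S \<longleftrightarrow>
     S \<subseteq> verts (localization G T) \<and> independent_set G S"
  by (auto simp: independent_set_def localization_def dominates_induce_iff)

lemma independent_set_localization_singleton:
  assumes "v \<in> verts G"
  shows "independent_set (localization G {v}) S \<longleftrightarrow> v \<notin> S \<and> independent_set G (insert v S)"
proof -
  have "verts (localization G {v}) = {u \<in> verts G. u \<noteq> v \<and> \<not> u \<rightarrow>\<^bsub>G\<^esub> v}"
    using dominates_sym by (auto simp: localization_def closed_nbhd_def nbhd_singleton)
  moreover have "S \<subseteq> verts G" if "independent_set G S"
    using that by (simp add: independent_set_def)
  ultimately show ?thesis
    using assms by (auto simp: independent_set_localization_iff independent_set_insert_iff)
qed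

lemma nbhd_localization:
  assumes "v \<notin> S" "independent_set G (insert v S)"
  shows "nbhd (localization G S) {v} = nbhd G {v} - nbhd G S"
proof -
  have "\<not> v \<rightarrow>\<^bsub>G\<^esub> u" "\<not> u \<rightarrow>\<^bsub>G\<^esub> v" if "u \<in> S" for u
    using assms that by (auto simp: independent_set_def)
  moreover have "v \<in> verts G"
    using assms by (simp add: independent_set_insert_iff)
  ultimately show ?thesis
    using assms(1) not_dominates_self adj_in_verts
    by (fastforce simp: nbhd_def localization_def closed_nbhd_def dominates_induce_iff)
qed

lemma insert_free_neighbour:
  assumes "independent_set G (insert v S)" "u \<in> nbhd G {v} - nbhd G S"
  shows "u \<notin> S" "independent_set G (insert u S)"
proof -
  have adj: "v \<rightarrow>\<^bsub>G\<^esub> u" using assms by (simp add: nbhd_singleton)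
  then show "u \<notin> S" using assms by (auto simp: independent_set_def)
  then show "independent_set G (insert u S)"
    using assms adj adj_in_verts by (auto simp: independent_set_insert_iff nbhd_def)
qed

text \<open>Two non-adjacent free neighbours in place of \<open>v\<close> would enlarge a maximum independent set.\<close>

lemma free_neighbours_clique:
  assumes "max_independent_set G (insert v S)" "v \<notin> S"
    and "u \<in> nbhd G {v} - nbhd G S" "w \<in> nbhd G {v} - nbhd G S" "u \<noteq> w"
  shows "u \<rightarrow>\<^bsub>G\<^esub> w"
proof (rule ccontr)
  assume "\<not> u \<rightarrow>\<^bsub>G\<^esub> w"
  have ind: "independent_set G (insert v S)"
    using assms(1) by (simp add: max_independent_set_def)
  note u = insert_free_neighbour[OF ind assms(3)] and w = insert_free_neighbour[OF ind assms(4)]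
  have "independent_set G (insert w (insert u S))"
    using u w \<open>\<not> u \<rightarrow>\<^bsub>G\<^esub> w\<close> by (simp add: independent_set_insert_iff)
  then have "card (insert w (insert u S)) \<le> independence_number G"
    by (rule card_le_independence_number)
  moreover have "finite S" using finite_independent_set[OF ind] by simp
  ultimately show False
    using assms(1,2,5) u(1) w(1) by (simp add: max_independent_set_def)
qed

lemma max_independent_set_exchange:
  assumes "max_independent_set G (insert v S)" "v \<notin> S" "u \<in> nbhd G {v} - nbhd G S"
  shows "max_independent_set G (insert u S)"
proof -
  have ind: "independent_set G (insert v S)"
    using assms(1) by (simp add: max_independent_set_def)
  moreover have "finite S" using finite_independent_set[OF ind] by simp
  ultimately show ?thesis
    using assms insert_free_neighbour[OF ind assms(3)] by (simp add: max_independent_set_def)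
qed

text \<open>
  An independent set meets the clique of free neighbours at most once, so fewer independent sets
  than free neighbours cannot cover that clique.
\<close>

lemma free_neighbour_outside:
  assumes "max_independent_set G (insert v S)" "v \<notin> S"
    and "finite I" "\<And>i. i \<in> I \<Longrightarrow> independent_set G (B i)"
    and "card I < card (nbhd G {v} - nbhd G S)"
  obtains u where "u \<in> nbhd G {v} - nbhd G S" "\<forall>i\<in>I. u \<notin> B i"
proof -
  let ?U = "nbhd G {v} - nbhd G S"
  have "\<not> ?U \<subseteq> (\<Union>i\<in>I. B i)"
  proof
    assume sub: "?U \<subseteq> (\<Union>i\<in>I. B i)"
    have le: "card (?U \<inter> B i) \<le> 1" if "i \<in> I" for i
    proof -
      have "a = b" if "a \<in> ?U \<inter> B i" "b \<in> ?U \<inter> B i" for a b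
        using free_neighbours_clique[OF assms(1,2), of a b] assms(4)[OF \<open>i \<in> I\<close>] that
        by (auto simp: independent_set_def)
      then show ?thesis
        by (metis card_eq_0_iff card_le_Suc0_iff_eq One_nat_def le0)
    qed
    have "?U = (\<Union>i\<in>I. ?U \<inter> B i)" using sub by blast
    then have "card ?U \<le> (\<Sum>i\<in>I. card (?U \<inter> B i))"
      using card_UN_le[OF assms(3), of "\<lambda>i. ?U \<inter> B i"] by simp
    also have "\<dots> \<le> card I" using sum_mono[of I, OF le] by simp
    finally show False using assms(5) by simp
  qed
  then show thesis using that by blast
qed

end

section \<open>Deleting a vertex from a graph of the class\<close>

lemma W_class_extend:
  assumes "G \<in> W_class p" "\<And>i. i \<in> {1..p} \<Longrightarrow> independent_set G (A i)"
    and "disjoint_family_on A {1..p}"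
  obtains M where "\<And>i. i \<in> {1..p} \<Longrightarrow> max_independent_set G (M i)"
    "disjoint_family_on M {1..p}" "\<And>i. i \<in> {1..p} \<Longrightarrow> A i \<subseteq> M i"
proof -
  have "\<exists>M. (\<forall>i\<in>{1..p}. max_independent_set G (M i)) \<and> disjoint_family_on M {1..p} \<and>
          (\<forall>i\<in>{1..p}. A i \<subseteq> M i)"
    using assms by (simp add: W_class_def)
  then obtain M where M: "\<forall>i\<in>{1..p}. max_independent_set G (M i)" "disjoint_family_on M {1..p}"
    "\<forall>i\<in>{1..p}. A i \<subseteq> M i"
    by (elim exE conjE)
  show thesis
  proof (rule that)
    show "max_independent_set G (M i)" if "i \<in> {1..p}" for i using M(1) that ..
    show "disjoint_family_on M {1..p}" by (rule M(2))
    show "A i \<subseteq> M i" if "i \<in> {1..p}" for i using M(3) that ..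
  qed
qed

text \<open>A maximum independent set that contains a neighbour of \<open>v\<close> cannot contain \<open>v\<close>.\<close>

lemma W_class_max_independent_set_avoiding:
  assumes "1 \<le> p" "G \<in> W_class p" "\<not> isolated G v"
  obtains M where "max_independent_set G M" "v \<notin> M"
proof -
  interpret graph G using assms(2) by (simp add: W_class_def)
  obtain u where u: "v \<rightarrow>\<^bsub>G\<^esub> u" using assms(3) by (auto simp: isolated_def nbhd_singleton)
  define A where "A i = (if i = 1 then {u} else {})" for i :: nat
  have "independent_set G (A i)" for i
    using u adj_in_verts independent_set_singleton by (auto simp: A_def independent_set_def)
  moreover have "disjoint_family_on A {1..p}"
    by (auto simp: disjoint_family_on_def A_def)
  ultimately obtain M where M: "\<And>i. i \<in> {1..p} \<Longrightarrow> max_independent_set G (M i)"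
    "\<And>i. i \<in> {1..p} \<Longrightarrow> A i \<subseteq> M i"
    using W_class_extend[OF assms(2), of A] by metis
  have "max_independent_set G (M 1)" "u \<in> M 1"
    using M[of 1] assms(1) by (simp_all add: A_def)
  then show thesis
    using that u by (auto simp: max_independent_set_def independent_set_def)
qed

text \<open>
  Disjointness from the sets that have taken the free neighbours keeps the set extending \<open>S\<close> away
  from all of \<open>N(v)\<close>, so that \<open>v\<close> can be added to it.
\<close>

lemma card_free_neighbours_ge:
  assumes "1 \<le> p" "G \<in> W_class p" "\<not> isolated G v"
    and "pre_digraph.del_vert G v \<in> W_class p"
    and "v \<notin> S" "independent_set G (insert v S)"
  shows "p \<le> card (nbhd G {v} - nbhd G S)"
proof (rule ccontr)
  let ?U = "nbhd G {v} - nbhd G S"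
  assume few: "\<not> p \<le> card ?U"
  interpret graph G using assms(2) by (simp add: W_class_def)
  obtain M0 where M0: "max_independent_set G M0" "v \<notin> M0"
    using W_class_max_independent_set_avoiding[OF assms(1-3)] .
  note max_iff = max_independent_set_del_vert_iff[OF M0]
  have "finite ?U" by (simp add: nbhd_def)
  then obtain n h where "n < p" and h: "bij_betw h {1..n} ?U"
    using ex_bij_betw_nat_finite_1 few not_le by metis
  \<comment> \<open>The first \<open>n\<close> indices take one free neighbour each; \<open>n < p\<close> leaves the index \<open>p\<close> for \<open>S\<close>.\<close>
  define A where "A i = (if i \<in> {1..n} then {h i} else if i = p then S else {})" for i
  have hU: "h i \<in> ?U" if "i \<in> {1..n}" for i
    using bij_betw_apply[OF h that] .
  have "independent_set (del_vert v) (A i)" for i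
    using hU[of i] assms(5,6) adj_in_verts independent_set_singleton not_dominates_self
    by (auto simp: A_def independent_set_del_vert_iff nbhd_singleton independent_set_insert_iff
        independent_set_def[of G "{}"])
  moreover have "disjoint_family_on A {1..p}"
    using bij_betw_imp_inj_on[OF h] hU insert_free_neighbour(1)[OF assms(6)]
    by (auto simp: disjoint_family_on_def A_def dest: inj_onD)
  ultimately obtain M where M: "\<And>i. i \<in> {1..p} \<Longrightarrow> max_independent_set (del_vert v) (M i)"
    "disjoint_family_on M {1..p}" "\<And>i. i \<in> {1..p} \<Longrightarrow> A i \<subseteq> M i"
    using W_class_extend[OF assms(4), of A] by metis
  have p: "p \<in> {1..p}" "p \<notin> {1..n}" using assms(1) \<open>n < p\<close> by auto
  have Mp: "max_independent_set G (M p)" "v \<notin> M p" "S \<subseteq> M p"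
    using M(1)[OF p(1)] M(3)[OF p(1)] p(2) by (auto simp: max_iff A_def)
  have free: "u \<notin> M p" if u: "u \<in> ?U" for u
  proof -
    obtain i where i: "i \<in> {1..n}" "u = h i"
      using u bij_betw_imp_surj_on[OF h] by blast
    then have "i \<in> {1..p}" "i \<noteq> p" using \<open>n < p\<close> by auto
    then show ?thesis
      using disjoint_family_onD[OF M(2), of i p] M(3)[of i] p(1) i by (auto simp: A_def)
  qed
  moreover have "u \<notin> M p" if "u \<in> nbhd G S" for u
    using that Mp(1,3) unfolding nbhd_def max_independent_set_def independent_set_def by blast
  ultimately have "\<not> w \<rightarrow>\<^bsub>G\<^esub> v" if "w \<in> M p" for w
    using that dominates_sym by (auto simp: nbhd_singleton)
  then have "independent_set G (insert v (M p))"
    using Mp(1) assms(6) by (simp add: independent_set_insert_iff max_independent_set_def)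
  then have "card (insert v (M p)) \<le> independence_number G"
    by (rule card_le_independence_number)
  moreover have "finite (M p)"
    using Mp(1) finite_independent_set by (simp add: max_independent_set_def)
  ultimately show False using Mp by (simp add: max_independent_set_def)
qed

text \<open>Here \<open>v\<close> is exchanged, in the one set that may contain it, for a free neighbour.\<close>

lemma W_class_del_vert:
  assumes "1 \<le> p" "G \<in> W_class p" "v \<in> verts G" "\<not> isolated G v"
    and many: "\<And>S. v \<notin> S \<Longrightarrow> independent_set G (insert v S)
                 \<Longrightarrow> p \<le> card (nbhd G {v} - nbhd G S)"
  shows "pre_digraph.del_vert G v \<in> W_class p"
proof -
  interpret graph G using assms(2) by (simp add: W_class_def)
  obtain M0 where M0: "max_independent_set G M0" "v \<notin> M0"
    using W_class_max_independent_set_avoiding[OF assms(1,2,4)] .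
  note max_iff = max_independent_set_del_vert_iff[OF M0]
  \<comment> \<open>The empty set is independent, so the degree of \<open>v\<close> bounds the order of \<open>G - v\<close>.\<close>
  have "p \<le> card (nbhd G {v} - nbhd G {})"
    using many[of "{}"] independent_set_singleton[OF assms(3)] by simp
  also have "\<dots> \<le> card (verts (del_vert v))"
    by (intro card_mono) (auto simp: nbhd_def verts_del_vert)
  finally have size: "p \<le> card (verts (del_vert v))" .
  have "\<exists>T. (\<forall>i\<in>{1..p}. max_independent_set (del_vert v) (T i)) \<and>
            disjoint_family_on T {1..p} \<and> (\<forall>i\<in>{1..p}. A i \<subseteq> T i)"
    if A: "\<forall>i\<in>{1..p}. independent_set (del_vert v) (A i)" "disjoint_family_on A {1..p}" for A
  proof -
    have vA: "v \<notin> A i" "independent_set G (A i)" if "i \<in> {1..p}" for i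
      using A(1) that by (auto simp: independent_set_del_vert_iff)
    obtain M where M: "\<And>i. i \<in> {1..p} \<Longrightarrow> max_independent_set G (M i)"
      "disjoint_family_on M {1..p}" "\<And>i. i \<in> {1..p} \<Longrightarrow> A i \<subseteq> M i"
      using W_class_extend[OF assms(2) vA(2) A(2)] by metis
    show ?thesis
    proof (cases "\<exists>j\<in>{1..p}. v \<in> M j")
      case False
      then show ?thesis using M max_iff by blast
    next
      case True
      then obtain j where j: "j \<in> {1..p}" "v \<in> M j" by blast
      define S where "S = M j - {v}"
      have vS: "v \<notin> S" and Mj: "M j = insert v S" using j by (auto simp: S_def)
      have maxS: "max_independent_set G (insert v S)" using M(1)[OF j(1)] Mj by simp
      have "p \<le> card (nbhd G {v} - nbhd G S)"
        using many[OF vS] maxS by (simp add: max_independent_set_def)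
      moreover have "card ({1..p} - {j}) < p" using j(1) by simp
      ultimately obtain u where u: "u \<in> nbhd G {v} - nbhd G S" "\<forall>i\<in>{1..p} - {j}. u \<notin> M i"
        using M(1) free_neighbour_outside[OF maxS vS, of "{1..p} - {j}" M]
        by (auto simp: max_independent_set_def)
      have "u \<noteq> v" using u(1) not_dominates_self by (auto simp: nbhd_singleton)
      define T where "T = M(j := insert u S)"
      have other: "v \<notin> M i" if "i \<in> {1..p}" "i \<noteq> j" for i
        using disjoint_family_onD[OF M(2) that(1) j(1) that(2)] j(2) by blast
      have "max_independent_set (del_vert v) (T i)" if "i \<in> {1..p}" for i
        using that M(1) other vS \<open>u \<noteq> v\<close> max_independent_set_exchange[OF maxS vS u(1)]
        by (auto simp: T_def max_iff)
      moreover have "disjoint_family_on T {1..p}"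
        unfolding disjoint_family_on_def
      proof (intro ballI impI)
        fix i k
        assume ik: "i \<in> {1..p}" "k \<in> {1..p}" "i \<noteq> k"
        have "M i \<inter> M k = {}" using disjoint_family_onD[OF M(2) ik] .
        moreover have "u \<notin> M l" if "l \<in> {1..p}" "l \<noteq> j" for l using u(2) that by blast
        ultimately show "T i \<inter> T k = {}" using ik by (auto simp: T_def S_def)
      qed
      moreover have "A i \<subseteq> T i" if "i \<in> {1..p}" for i
        using that M(3)[OF that] vA(1)[OF that] Mj by (auto simp: T_def)
      ultimately show ?thesis by blast
    qed
  qed
  then show ?thesis
    using size graph_del_vert unfolding W_class_def by simp
qed

theorem theorem3p3:
  fixes G :: "('a,'b) pre_digraph" and p :: nat and v :: 'a
  assumes "p \<ge> 1"
    and "G \<in> W_class p"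
    and "v \<in> verts G"
    and "\<not> isolated G v"
  shows "(pre_digraph.del_vert G v \<in> W_class p \<longleftrightarrow>
            (\<forall>S. independent_set (localization G {v}) S \<longrightarrow>
               card (nbhd G {v} - nbhd G S) \<ge> p))
       \<and> ((\<forall>S. independent_set (localization G {v}) S \<longrightarrow>
               card (nbhd G {v} - nbhd G S) \<ge> p) \<longleftrightarrow>
            \<not> (\<exists>S. S \<subseteq> verts (localization G {v}) \<and> independent_set G S \<and>
                card (nbhd (localization G S) {v}) \<le> p - 1))"
proof -
  interpret graph G using assms(2) by (simp add: W_class_def)
  note loc = independent_set_localization_singleton[OF assms(3)]
  have "S \<subseteq> verts (localization G {v}) \<and> independent_set G S \<and>
          card (nbhd (localization G S) {v}) \<le> p - 1 \<longleftrightarrow>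
        independent_set (localization G {v}) S \<and> \<not> p \<le> card (nbhd G {v} - nbhd G S)" for S
  proof -
    have "card (nbhd (localization G S) {v}) \<le> p - 1 \<longleftrightarrow> \<not> p \<le> card (nbhd G {v} - nbhd G S)"
      if "independent_set (localization G {v}) S"
      using that nbhd_localization assms(1) by (auto simp: loc)
    then show ?thesis using independent_set_localization_iff by blast
  qed
  then show ?thesis
    using card_free_neighbours_ge[OF assms(1,2,4)] W_class_del_vert[OF assms]
    unfolding loc by blast
qed

end
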